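(* Let $X\subset\mathcal{H}ol(\mathbb{D})$ be a unital Banach algebra whose exact predual $Y$ (with respect to the Cauchy pairing) satisfies the division property: $h\in Y\implies\frac{h-h(0)}{z}\in Y$. Let $\lambda$ be a finite sequence in $\mathbb{D}$ consisting of distinct points $\lambda_1,\dots,\lambda_n$ with multiplicities $n_1,\dots,n_n\ge1$, with $K_\lambda\subset Y$. Then for every analytic polynomial $g$, $$I_X(\lambda,g(\lambda))=\big\|g(S)^\star|_{K_\lambda}\big\|_{Y\to Y}:=\sup_{h\in K_\lambda,\ h\neq0}\frac{\|g(S)^\star h\|_Y}{\|h\|_Y},$$ where $$I_X(\lambda,g(\lambda))=\inf\left\{\|f\|_X:\ f\in X,\ f^{(j)}(\lambda_i)=g^{(j)}(\lambda_i),\ 1\le i\le n,\ 0\le j<n_i\right\}.$$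
   Context: $\mathbb{D}$ is the open unit disk, $\mathcal{H}ol(\mathbb{D})$ the holomorphic functions on it, $\hat f(k)$ the $k$-th Taylor coefficient of $f$ at $0$. The Cauchy pairing is $\langle h,f\rangle=\sum_{k\ge0}\hat h(k)\overline{\hat f(k)}$. $X$ is a Banach space continuously embedded in $\mathcal{H}ol(\mathbb{D})$. Unital Banach algebra means: $1\in X$, and for all $f_1,f_2\in X$ the product $f_1f_2$ is in $X$ with $\|f_1f_2\|_X\le\|f_1\|_X\|f_2\|_X$. $Y$ is the exact predual of $X$ means: $Y$ is a Banach space of holomorphic functions on $\mathbb{D}$ in which the analytic polynomials form a dense subset, and $X=Y'$ isometrically through the pairing: every $f\in X$ defines a bounded linear functional $\langle\cdot,f\rangle$ on $Y$, every bounded linear functional on $Y$ is of this form for a unique $f\in X$, and $\|f\|_X=\sup_{0\neq h\in Y}\frac{|\langle h,f\rangle|}{\|h\|_Y}$, $\|h\|_Y=\sup_{0\neq f\in X}\frac{|\langle h,f\rangle|}{\|f\|_X}$. For $h$ a polynomial or $h\in K_\lambda$, $\langle h,f\rangle$ is the (absolutely convergent) series above; for other $h\in Y$ it is the continuous extension from polynomials. $K_\lambda=\mathrm{span}\{k_{\lambda_i,j}:1\le i\le n,\ 0\le j<n_i\}$, where $k_{\mu,j}=\left(\frac{d}{d\bar\mu}\right)^j\frac1{1-\bar\mu z}=\sum_{k\ge j}\frac{k!}{(k-j)!}\bar\mu^{\,k-j}z^k$. Equivalently $K_\lambda=H^2\cap(BH^2)^\perp$, where $H^2$ is the Hardy space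 and $B=\prod_{i=1}^n\left(\frac{z-\lambda_i}{1-\overline{\lambda_i}z}\right)^{n_i}$ is the Blaschke product associated with $\lambda$. $S$ is the multiplication operator $f\mapsto zf$ on $X$. $S^\star$ is its adjoint with respect to the pairing, acting on $Y$ as the backward shift $S^\star h=\frac{h-h(0)}{z}$; it leaves $K_\lambda$ invariant. For $g(z)=\sum_k a_kz^k$, $g(S)^\star=\sum_k\overline{a_k}(S^\star)^k$.
   Formalization: The unital Banach algebra X is additionally assumed to satisfy ‖1‖_X = 1; without this normalization the claim fails (e.g. the Wiener algebra with twice its usual norm, λ = {0}, g = 1 gives 2 on the left and 1 on the right). *)

theory Defs
  imports "HOL-Complex_Analysis.Complex_Analysis"
begin

section \<open>Banach spaces of holomorphic functions on the unit disk\<close>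

text \<open>A function on the open unit disk is represented by its extension by \<open>0\<close> to the whole plane,
  so that equality of functions on the disk is equality in HOL.\<close>

abbreviation disk :: "complex set" where
  "disk \<equiv> ball 0 1"

definition on_disk :: "(complex \<Rightarrow> complex) \<Rightarrow> complex \<Rightarrow> complex" where
  "on_disk f = (\<lambda>z. if z \<in> disk then f z else 0)"

definition Hol_disk :: "(complex \<Rightarrow> complex) set" where
  "Hol_disk = {f. f holomorphic_on disk \<and> (\<forall>z. z \<notin> disk \<longrightarrow> f z = 0)}"

locale hol_banach_space =
  fixes E :: "(complex \<Rightarrow> complex) set" and N :: "(complex \<Rightarrow> complex) \<Rightarrow> real"
  assumes subset_Hol: "E \<subseteq> Hol_disk"
    and zero_mem: "(\<lambda>z. 0) \<in> E"
    and add_mem: "f \<in> E \<Longrightarrow> g \<in> E \<Longrightarrow> (\<lambda>z. f z + g z) \<in> E"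
    and scale_mem: "f \<in> E \<Longrightarrow> (\<lambda>z. c * f z) \<in> E"
    and norm_nonneg: "f \<in> E \<Longrightarrow> 0 \<le> N f"
    and norm_eq_zero: "f \<in> E \<Longrightarrow> N f = 0 \<longleftrightarrow> f = (\<lambda>z. 0)"
    and norm_scale: "f \<in> E \<Longrightarrow> N (\<lambda>z. c * f z) = cmod c * N f"
    and norm_triangle: "f \<in> E \<Longrightarrow> g \<in> E \<Longrightarrow> N (\<lambda>z. f z + g z) \<le> N f + N g"
    and complete: "(\<And>i. s i \<in> E) \<Longrightarrow>
        (\<And>e. e > 0 \<Longrightarrow> \<exists>M. \<forall>i\<ge>M. \<forall>j\<ge>M. N (\<lambda>z. s i z - s j z) < e) \<Longrightarrow>
        \<exists>f\<in>E. (\<lambda>i::nat. N (\<lambda>z. s i z - f z)) \<longlonglongrightarrow> 0"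

text \<open>Continuity of the embedding refers to uniform convergence on compact subsets of the disk.
  As usual for unital Banach algebras, the unit has norm \<open>1\<close>.\<close>

locale unital_hol_banach_algebra = hol_banach_space X N
  for X :: "(complex \<Rightarrow> complex) set" and N :: "(complex \<Rightarrow> complex) \<Rightarrow> real" +
  assumes continuous_embedding:
      "compact K \<Longrightarrow> K \<subseteq> disk \<Longrightarrow> \<exists>C. \<forall>f\<in>X. \<forall>z\<in>K. cmod (f z) \<le> C * N f"
    and one_mem: "on_disk (\<lambda>z. 1) \<in> X"
    and norm_one: "N (on_disk (\<lambda>z. 1)) = 1"
    and mult_mem: "f \<in> X \<Longrightarrow> g \<in> X \<Longrightarrow> (\<lambda>z. f z * g z) \<in> X"
    and norm_mult: "f \<in> X \<Longrightarrow> g \<in> X \<Longrightarrow> N (\<lambda>z. f z * g z) \<le> N f * N g"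

section \<open>Cauchy pairing and exact predual\<close>

definition taylor_coeff :: "(complex \<Rightarrow> complex) \<Rightarrow> nat \<Rightarrow> complex" where
  "taylor_coeff f k = (deriv ^^ k) f 0 / fact k"

definition cauchy_series :: "(complex \<Rightarrow> complex) \<Rightarrow> (complex \<Rightarrow> complex) \<Rightarrow> complex" where
  "cauchy_series h f = (\<Sum>k. taylor_coeff h k * cnj (taylor_coeff f k))"

definition bounded_functional ::
  "(complex \<Rightarrow> complex) set \<Rightarrow> ((complex \<Rightarrow> complex) \<Rightarrow> real) \<Rightarrow> ((complex \<Rightarrow> complex) \<Rightarrow> complex) \<Rightarrow> bool"
where
  "bounded_functional E N L \<longleftrightarrow>
     (\<forall>f\<in>E. \<forall>g\<in>E. L (\<lambda>z. f z + g z) = L f + L g) \<and>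
     (\<forall>f\<in>E. \<forall>c. L (\<lambda>z. c * f z) = c * L f) \<and>
     (\<exists>C. \<forall>f\<in>E. cmod (L f) \<le> C * N f)"

text \<open>\<open>pair h f\<close> is the pairing of \<open>h \<in> Y\<close> with \<open>f \<in> X\<close>. It is given by the Cauchy series for
  polynomials \<open>h\<close>; since \<open>pair \<cdot> f\<close> is bounded on \<open>Y\<close> and the polynomials are dense,
  it is thereby determined on all of \<open>Y \<times> X\<close>. The suprema are taken in the extended nonnegative
  reals, so that no default value of an unbounded supremum is involved.\<close>

locale exact_predual = X: hol_banach_space X NX + Y: hol_banach_space Y NY
  for X :: "(complex \<Rightarrow> complex) set" and NX :: "(complex \<Rightarrow> complex) \<Rightarrow> real"
    and Y :: "(complex \<Rightarrow> complex) set" and NY :: "(complex \<Rightarrow> complex) \<Rightarrow> real" +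
  fixes pair :: "(complex \<Rightarrow> complex) \<Rightarrow> (complex \<Rightarrow> complex) \<Rightarrow> complex"
  assumes poly_mem: "on_disk (poly p) \<in> Y"
    and poly_dense: "h \<in> Y \<Longrightarrow> e > 0 \<Longrightarrow> \<exists>p. NY (\<lambda>z. h z - on_disk (poly p) z) < e"
    and pair_poly: "f \<in> X \<Longrightarrow> pair (on_disk (poly p)) f = cauchy_series (on_disk (poly p)) f"
    and pair_bounded: "f \<in> X \<Longrightarrow> bounded_functional Y NY (\<lambda>h. pair h f)"
    and represent: "bounded_functional Y NY L \<Longrightarrow> \<exists>!f. f \<in> X \<and> (\<forall>h\<in>Y. L h = pair h f)"
    and norm_X: "f \<in> X \<Longrightarrow>
        ennreal (NX f) = (SUP h \<in> Y - {\<lambda>z. 0}. ennreal (cmod (pair h f) / NY h))"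
    and norm_Y: "h \<in> Y \<Longrightarrow>
        ennreal (NY h) = (SUP f \<in> X - {\<lambda>z. 0}. ennreal (cmod (pair h f) / NX f))"

section \<open>The backward shift and the model space\<close>

text \<open>The value at \<open>0\<close> is the one filling the removable singularity of \<open>(h z - h 0) / z\<close>.\<close>

definition backward_shift :: "(complex \<Rightarrow> complex) \<Rightarrow> complex \<Rightarrow> complex" where
  "backward_shift h = on_disk (\<lambda>z. if z = 0 then deriv h 0 else (h z - h 0) / z)"

text \<open>The operator \<open>g(S)\<^sup>\<star>\<close>, where \<open>S\<close> is multiplication by \<open>z\<close> and its adjoint \<open>S\<^sup>\<star>\<close> with respect to
  the Cauchy pairing acts as the backward shift.\<close>

definition poly_shift_adjoint :: "complex poly \<Rightarrow> (complex \<Rightarrow> complex) \<Rightarrow> complex \<Rightarrow> complex" where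
  "poly_shift_adjoint g h = (\<lambda>z. \<Sum>k\<le>degree g. cnj (coeff g k) * (backward_shift ^^ k) h z)"

text \<open>The \<open>j\<close>-th derivative of \<open>1 / (1 - w z)\<close> with respect to \<open>w\<close>, taken at the conjugate of \<open>\<mu>\<close>.\<close>

definition kernel_fn :: "complex \<Rightarrow> nat \<Rightarrow> complex \<Rightarrow> complex" where
  "kernel_fn \<mu> j = on_disk (\<lambda>z. (deriv ^^ j) (\<lambda>w. 1 / (1 - w * z)) (cnj \<mu>))"

definition model_space :: "nat \<Rightarrow> (nat \<Rightarrow> complex) \<Rightarrow> (nat \<Rightarrow> nat) \<Rightarrow> (complex \<Rightarrow> complex) set" where
  "model_space n lam mlt =
     {h. \<exists>c. h = (\<lambda>z. \<Sum>i=1..n. \<Sum>j<mlt i. c i j * kernel_fn (lam i) j z)}"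

section \<open>The two quantities\<close>

definition interpolation_norm ::
  "(complex \<Rightarrow> complex) set \<Rightarrow> ((complex \<Rightarrow> complex) \<Rightarrow> real) \<Rightarrow>
   nat \<Rightarrow> (nat \<Rightarrow> complex) \<Rightarrow> (nat \<Rightarrow> nat) \<Rightarrow> complex poly \<Rightarrow> ennreal"
where
  "interpolation_norm X NX n lam mlt g =
     (INF f \<in> {f \<in> X. \<forall>i\<in>{1..n}. \<forall>j<mlt i. (deriv ^^ j) f (lam i) = (deriv ^^ j) (poly g) (lam i)}.
        ennreal (NX f))"

definition restricted_opnorm ::
  "(complex \<Rightarrow> complex) set \<Rightarrow> ((complex \<Rightarrow> complex) \<Rightarrow> real) \<Rightarrow>
   ((complex \<Rightarrow> complex) \<Rightarrow> complex \<Rightarrow> complex) \<Rightarrow> ennreal"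
where
  "restricted_opnorm K N T = (SUP h \<in> K - {\<lambda>z. 0}. ennreal (N (T h) / N h))"

end

theory Submission
  imports Defs "HOL-Library.Function_Algebras"
begin

text \<open>Pairing with the kernel \<open>k\<^sub>\<mu>\<^sub>,\<^sub>j\<close> evaluates the conjugate of \<open>f\<^sup>(\<^sup>j\<^sup>)(\<mu>)\<close>, so \<open>f\<close> interpolates \<open>g\<close>
  if and only if \<open>\<langle>h, f\<rangle> = \<langle>h, g\<rangle>\<close> for all \<open>h\<close> in the model space \<open>K\<close>. There
  \<open>\<langle>g(S)\<^sup>\<star> h, f\<rangle> = \<langle>h, g f\<rangle>\<close>, and this depends on \<open>g\<close> only through its interpolation data. If \<open>F \<in> X\<close>
  interpolates \<open>g\<close>, then \<open>\<langle>g(S)\<^sup>\<star> h, f\<rangle> = \<langle>h, F f\<rangle>\<close> is bounded by \<open>\<parallel>F\<parallel> \<parallel>f\<parallel> \<parallel>h\<parallel>\<close>, which bounds the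
  operator norm by \<open>\<parallel>F\<parallel>\<close>. Conversely \<open>\<langle>h, g\<rangle> = \<langle>g(S)\<^sup>\<star> h, 1\<rangle>\<close> is a functional on \<open>K\<close> bounded by the
  operator norm; a Hahn-Banach extension to \<open>Y\<close> is represented by an interpolant in \<open>X\<close> of no larger
  norm. Only pairings with elements of \<open>K\<close> are used, so \<open>g\<close> itself need not be shown to lie in \<open>X\<close>.\<close>

section \<open>The Hahn-Banach theorem\<close>

text \<open>The scalar multiplication is a parameter \<open>s\<close>, so that a complex space can
  be used with its scalars restricted to the reals. Sublinearity is asked on \<open>E\<close> only,
  since a norm of a function space says nothing about functions outside it.\<close>

lemma hahn_banach_real:
  fixes s :: "real \<Rightarrow> 'v::ab_group_add \<Rightarrow> 'v" and p u :: "'v \<Rightarrow> real"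
  assumes vs: "vector_space s"
    and E: "module.subspace s E" and K: "module.subspace s K" "K \<subseteq> E"
    and p_add: "\<And>x y. x \<in> E \<Longrightarrow> y \<in> E \<Longrightarrow> p (x + y) \<le> p x + p y"
    and p_scale: "\<And>c x. c > 0 \<Longrightarrow> x \<in> E \<Longrightarrow> p (s c x) = c * p x"
    and u_add: "\<And>x y. x \<in> K \<Longrightarrow> y \<in> K \<Longrightarrow> u (x + y) = u x + u y"
    and u_scale: "\<And>c x. x \<in> K \<Longrightarrow> u (s c x) = c * u x"
    and u_le: "\<And>x. x \<in> K \<Longrightarrow> u x \<le> p x"
  shows "\<exists>U. (\<forall>x\<in>K. U x = u x) \<and> (\<forall>x\<in>E. \<forall>y\<in>E. U (x + y) = U x + U y) \<and>
             (\<forall>x\<in>E. \<forall>c. U (s c x) = c * U x) \<and> (\<forall>x\<in>E. U x \<le> p x)"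
proof -
  interpret V: vector_space s by (rule vs)
  have p0: "p 0 = 0"
    using p_scale[of 2 0] V.subspace_0[OF E] by simp
  \<comment> \<open>Zorn's lemma is applied to graphs of extensions; a linear \<open>G\<close> lying below the graph of \<open>p\<close>
    is automatically single-valued, because \<open>(0, a)\<close> and \<open>(0, -a)\<close> force \<open>a = 0\<close>.\<close>
  define \<G> where "\<G> = {G. (\<lambda>x. (x, u x)) ` K \<subseteq> G \<and> fst ` G \<subseteq> E \<and>
      (\<forall>x a y b. (x, a) \<in> G \<longrightarrow> (y, b) \<in> G \<longrightarrow> (x + y, a + b) \<in> G) \<and>
      (\<forall>x a c. (x, a) \<in> G \<longrightarrow> (s c x, c * a) \<in> G) \<and>
      (\<forall>x a. (x, a) \<in> G \<longrightarrow> a \<le> p x)}"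
  have "(\<lambda>x. (x, u x)) ` K \<in> \<G>"
    using K u_add u_scale u_le
    by (auto simp: \<G>_def image_iff V.subspace_add V.subspace_scale)
  \<comment> \<open>Two pairs from the union already lie in one member of the chain, so closure
    under addition survives; the other conditions concern one pair at a time.\<close>
  moreover have "\<Union>C \<in> \<G>" if "C \<noteq> {}" "subset.chain \<G> C" for C
  proof -
    have sub: "C \<subseteq> \<G>" and tot: "\<And>A B. A \<in> C \<Longrightarrow> B \<in> C \<Longrightarrow> A \<subseteq> B \<or> B \<subseteq> A"
      using that(2) by (auto simp: subset_chain_def)
    have "(x + y, a + b) \<in> \<Union>C" if "(x, a) \<in> A" "A \<in> C" "(y, b) \<in> B" "B \<in> C" for x a y b A B
    proof -
      obtain D where "D \<in> C" "(x, a) \<in> D" "(y, b) \<in> D"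
        using tot[OF \<open>A \<in> C\<close> \<open>B \<in> C\<close>] \<open>(x, a) \<in> A\<close> \<open>(y, b) \<in> B\<close> \<open>A \<in> C\<close> \<open>B \<in> C\<close> by blast
      then show ?thesis using sub unfolding \<G>_def by blast
    qed
    moreover have "(\<lambda>x. (x, u x)) ` K \<subseteq> \<Union>C"
      using \<open>C \<noteq> {}\<close> sub unfolding \<G>_def by blast
    moreover have "fst ` \<Union>C \<subseteq> E" using sub unfolding \<G>_def by blast
    moreover have "\<forall>x a c. (x, a) \<in> \<Union>C \<longrightarrow> (s c x, c * a) \<in> \<Union>C"
      using sub unfolding \<G>_def by blast
    moreover have "\<forall>x a. (x, a) \<in> \<Union>C \<longrightarrow> a \<le> p x"
      using sub unfolding \<G>_def by blast
    ultimately show ?thesis unfolding \<G>_def by blast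
  qed
  ultimately obtain M where M: "M \<in> \<G>" and max: "\<And>G. G \<in> \<G> \<Longrightarrow> M \<subseteq> G \<Longrightarrow> G = M"
    using subset_Zorn_nonempty[of \<G>] by blast
  have Mu: "(x, u x) \<in> M" if "x \<in> K" for x using M that by (auto simp: \<G>_def)
  have ME: "x \<in> E" if "(x, a) \<in> M" for x a using M that by (force simp: \<G>_def)
  have Madd: "(x + y, a + b) \<in> M" if "(x, a) \<in> M" "(y, b) \<in> M" for x a y b
    using M that by (auto simp: \<G>_def)
  have Mscale: "(s c x, c * a) \<in> M" if "(x, a) \<in> M" for x a c using M that by (auto simp: \<G>_def)
  have Mp: "a \<le> p x" if "(x, a) \<in> M" for x a using M that by (auto simp: \<G>_def)
  have M0: "(0, 0) \<in> M" using Mscale[of _ _ 0] Mu[of 0] V.subspace_0[OF K(1)] by fastforce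
  have single: "a = b" if "(x, a) \<in> M" "(x, b) \<in> M" for x a b
  proof -
    have "(0, a - b) \<in> M" "(0, b - a) \<in> M"
      using Madd[OF that(1) Mscale[OF that(2), of "-1"]] Madd[OF that(2) Mscale[OF that(1), of "-1"]]
      by auto
    then show ?thesis using Mp[of 0 "a - b"] Mp[of 0 "b - a"] p0 by linarith
  qed
  \<comment> \<open>One-dimensional extension, carried out for every \<open>x0\<close> in
    \<open>E\<close>, also one already in the domain of \<open>M\<close>. The set \<open>G\<close>
    below need not be checked to be well defined, because any member of \<open>\<G>\<close> is
    single-valued, and maximality then puts \<open>x0\<close> into the domain of
    \<open>M\<close>.\<close>
  have total: "\<exists>a. (x0, a) \<in> M" if x0: "x0 \<in> E" for x0
  proof -
    \<comment> \<open>Every lower bound imposed by \<open>p\<close> on the value at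
      \<open>x0\<close> is at most every upper bound, so the supremum \<open>c\<close> of the lower
      bounds is an admissible value.\<close>
    have le: "a - p (x - x0) \<le> p (y + x0) - b" if "(x, a) \<in> M" "(y, b) \<in> M" for x a y b
    proof -
      have "a + b \<le> p (x + y)" using Mp[OF Madd[OF that]] .
      also have "x + y = (x - x0) + (y + x0)" by simp
      also have "p \<dots> \<le> p (x - x0) + p (y + x0)"
        by (rule p_add[OF V.subspace_diff[OF E ME[OF that(1)] x0] V.subspace_add[OF E ME[OF that(2)] x0]])
      finally show ?thesis by simp
    qed
    define A where "A = (\<lambda>(x, a). a - p (x - x0)) ` M"
    define c where "c = Sup A"
    have "A \<noteq> {}" using M0 by (auto simp: A_def)
    have c_le: "c \<le> p (y + x0) - b" if "(y, b) \<in> M" for y b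
      unfolding c_def using le that \<open>A \<noteq> {}\<close> by (intro cSup_least) (auto simp: A_def)
    have c_ge: "a - p (x - x0) \<le> c" if "(x, a) \<in> M" for x a
      unfolding c_def using that le[OF _ M0]
      by (intro cSup_upper bdd_aboveI[of _ "p (0 + x0) - 0"]) (auto simp: A_def intro: rev_image_eqI)
    define G where "G = {(x + s t x0, a + t * c) | x a t. (x, a) \<in> M}"
    have "M \<subseteq> G"
    proof clarify
      fix x a assume "(x, a) \<in> M"
      then show "(x, a) \<in> G" unfolding G_def
        by (intro CollectI exI[of _ x] exI[of _ a] exI[of _ 0]) auto
    qed
    moreover have "G \<in> \<G>"
    proof -
      have "(\<lambda>x. (x, u x)) ` K \<subseteq> G" using Mu \<open>M \<subseteq> G\<close> by auto
      moreover have "fst ` G \<subseteq> E"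
        using ME x0 by (auto simp: G_def intro!: V.subspace_add[OF E] V.subspace_scale[OF E])
      moreover have "(x + y, a + b) \<in> G" if G2: "(x, a) \<in> G" "(y, b) \<in> G" for x a y b
      proof -
        obtain x' a' t y' b' r where *: "x = x' + s t x0" "a = a' + t * c" "(x', a') \<in> M"
          "y = y' + s r x0" "b = b' + r * c" "(y', b') \<in> M"
          using G2 unfolding G_def by blast
        then have "x + y = (x' + y') + s (t + r) x0" "a + b = (a' + b') + (t + r) * c"
          by (simp_all add: V.scale_left_distrib algebra_simps)
        then show ?thesis unfolding G_def using Madd[OF *(3,6)] by blast
      qed
      moreover have "(s r x, r * a) \<in> G" if G1: "(x, a) \<in> G" for x a r
      proof -
        obtain x' a' t where *: "x = x' + s t x0" "a = a' + t * c" "(x', a') \<in> M"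
          using G1 unfolding G_def by blast
        then have "s r x = s r x' + s (r * t) x0" "r * a = r * a' + (r * t) * c"
          by (simp_all add: V.scale_right_distrib algebra_simps)
        then show ?thesis unfolding G_def using Mscale[OF *(3)] by blast
      qed
      \<comment> \<open>Dividing by the absolute value of \<open>t\<close> reduces the claim to
        \<open>c_le\<close> for positive \<open>t\<close> and to \<open>c_ge\<close> for negative
        \<open>t\<close>.\<close>
      moreover have "a + t * c \<le> p (x + s t x0)" if xa: "(x, a) \<in> M" for x a t
      proof -
        consider "t = 0" | "t > 0" | "t < 0" by linarith
        then show ?thesis
        proof cases
          case 1 then show ?thesis using Mp[OF xa] by simp
        next
          case 2
          have "s (1 / t) x + x0 \<in> E"
            by (intro V.subspace_add[OF E] V.subspace_scale[OF E] ME[OF xa] x0)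
          moreover have "s t (s (1 / t) x + x0) = x + s t x0" using 2 by (simp add: V.scale_right_distrib)
          ultimately have "p (x + s t x0) = t * p (s (1 / t) x + x0)"
            using p_scale[OF 2] by metis
          then show ?thesis using c_le[OF Mscale[OF xa, of "1 / t"]] 2 by (simp add: field_simps)
        next
          case 3
          have "s (1 / (-t)) x - x0 \<in> E"
            by (intro V.subspace_diff[OF E] V.subspace_scale[OF E] ME[OF xa] x0)
          moreover have "s (-t) (s (1 / (-t)) x - x0) = x + s t x0"
            using 3 by (simp add: V.scale_right_diff_distrib)
          ultimately have "p (x + s t x0) = -t * p (s (1 / (-t)) x - x0)"
            using p_scale[of "-t"] 3 by (metis neg_0_less_iff_less)
          then show ?thesis using c_ge[OF Mscale[OF xa, of "1 / (-t)"]] 3 by (simp add: field_simps)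
        qed
      qed
      then have "\<forall>x a. (x, a) \<in> G \<longrightarrow> a \<le> p x" by (auto simp: G_def)
      ultimately show ?thesis unfolding \<G>_def by blast
    qed
    ultimately have "G = M" using max by blast
    moreover have "(0 + s 1 x0, 0 + 1 * c) \<in> G" unfolding G_def using M0 by blast
    ultimately show ?thesis by auto
  qed
  define U where "U x = (THE a. (x, a) \<in> M)" for x
  have U: "U x = a" if "(x, a) \<in> M" for x a
    unfolding U_def using that single by blast
  have UM: "(x, U x) \<in> M" if "x \<in> E" for x using total[OF that] U by blast
  show ?thesis
    by (intro exI[of _ U] conjI ballI allI)
       (auto intro: U Mu Mp UM Madd Mscale)
qed

text \<open>A complex-linear functional is determined by its real part. That part is extended by the
  real theorem over the restricted scalars, and the complex functional is rebuilt from the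
  extension.\<close>

lemma hahn_banach_complex:
  fixes s :: "complex \<Rightarrow> 'v::ab_group_add \<Rightarrow> 'v" and p :: "'v \<Rightarrow> real" and L :: "'v \<Rightarrow> complex"
  assumes vs: "vector_space s"
    and E: "module.subspace s E" and K: "module.subspace s K" "K \<subseteq> E"
    and p_add: "\<And>x y. x \<in> E \<Longrightarrow> y \<in> E \<Longrightarrow> p (x + y) \<le> p x + p y"
    and p_scale: "\<And>c x. x \<in> E \<Longrightarrow> p (s c x) = cmod c * p x"
    and L_add: "\<And>x y. x \<in> K \<Longrightarrow> y \<in> K \<Longrightarrow> L (x + y) = L x + L y"
    and L_scale: "\<And>c x. x \<in> K \<Longrightarrow> L (s c x) = c * L x"
    and L_le: "\<And>x. x \<in> K \<Longrightarrow> cmod (L x) \<le> p x"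
  shows "\<exists>\<Lambda>. (\<forall>x\<in>K. \<Lambda> x = L x) \<and> (\<forall>x\<in>E. \<forall>y\<in>E. \<Lambda> (x + y) = \<Lambda> x + \<Lambda> y) \<and>
             (\<forall>x\<in>E. \<forall>c. \<Lambda> (s c x) = c * \<Lambda> x) \<and> (\<forall>x\<in>E. cmod (\<Lambda> x) \<le> p x)"
proof -
  interpret V: vector_space s by (rule vs)
  define r where "r c = s (complex_of_real c)" for c
  interpret R: vector_space r
    by unfold_locales (simp_all add: r_def V.scale_right_distrib V.scale_left_distrib)
  have subR: "R.subspace A" if "V.subspace A" for A
    using that by (auto simp: R.subspace_def V.subspace_def r_def)
  have "\<exists>U. (\<forall>x\<in>K. U x = Re (L x)) \<and> (\<forall>x\<in>E. \<forall>y\<in>E. U (x + y) = U x + U y) \<and>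
             (\<forall>x\<in>E. \<forall>c. U (r c x) = c * U x) \<and> (\<forall>x\<in>E. U x \<le> p x)"
    using L_le complex_Re_le_cmod order_trans
    by (intro hahn_banach_real R.vector_space_axioms subR E K p_add)
       (auto simp: L_add L_scale p_scale r_def, blast)
  then obtain U where UK: "\<And>x. x \<in> K \<Longrightarrow> U x = Re (L x)"
    and U_add: "\<And>x y. x \<in> E \<Longrightarrow> y \<in> E \<Longrightarrow> U (x + y) = U x + U y"
    and U_scale: "\<And>x c. x \<in> E \<Longrightarrow> U (s (complex_of_real c) x) = c * U x"
    and U_le: "\<And>x. x \<in> E \<Longrightarrow> U x \<le> p x"
    unfolding r_def by metis
  \<comment> \<open>The imaginary part is forced: for a complex-linear functional it equals minus
    the real part of the value at \<open>s \<i> x\<close>.\<close>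
  define \<Lambda> where "\<Lambda> x = Complex (U x) (- U (s \<i> x))" for x
  have scE: "s c x \<in> E" if "x \<in> E" for c x using V.subspace_scale[OF E that] .
  have \<Lambda>_add: "\<Lambda> (x + y) = \<Lambda> x + \<Lambda> y" if "x \<in> E" "y \<in> E" for x y
    using that scE by (simp add: \<Lambda>_def U_add V.scale_right_distrib complex_eq_iff)
  have \<Lambda>_scale: "\<Lambda> (s c x) = c * \<Lambda> x" if x: "x \<in> E" for c x
  proof -
    have split: "U (s w x) = Re w * U x + Im w * U (s \<i> x)" for w
    proof -
      have "s w x = s (of_real (Re w)) x + s (of_real (Im w)) (s \<i> x)"
        by (metis V.scale_left_distrib V.scale_scale complex_eq mult.commute)
      then show ?thesis using x scE by (simp only: U_add U_scale)
    qed
    \<comment> \<open>The factor \<open>c\<close> yields the real parts and \<open>\<i> * c\<close>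
      the imaginary parts.\<close>
    show ?thesis
      using split[of c] split[of "\<i> * c"] by (simp add: \<Lambda>_def complex_eq_iff algebra_simps)
  qed
  have \<Lambda>_le: "cmod (\<Lambda> x) \<le> p x" if x: "x \<in> E" for x
  proof -
    \<comment> \<open>Rotating by a unimodular \<open>w\<close> makes the value real and
      nonnegative, so the bound on the real part controls the modulus.\<close>
    obtain w where w: "cmod w = 1" "w * \<Lambda> x = of_real (cmod (\<Lambda> x))"
    proof (cases "\<Lambda> x = 0")
      case True then show ?thesis using that[of 1] by simp
    next
      case False
      then show ?thesis
        using that[of "of_real (cmod (\<Lambda> x)) / \<Lambda> x"] by (simp add: norm_divide)
    qed
    have "cmod (\<Lambda> x) = Re (\<Lambda> (s w x))" using \<Lambda>_scale[OF x] w by simp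
    also have "\<dots> = U (s w x)" by (simp add: \<Lambda>_def)
    also have "\<dots> \<le> p (s w x)" using U_le scE x by blast
    also have "\<dots> = p x" using p_scale[OF x] w by simp
    finally show ?thesis .
  qed
  have "\<Lambda> x = L x" if "x \<in> K" for x
    using UK[OF that] UK[OF V.subspace_scale[OF K(1) that]] L_scale[OF that]
    by (simp add: \<Lambda>_def complex_eq_iff)
  then show ?thesis using \<Lambda>_add \<Lambda>_scale \<Lambda>_le by blast
qed

section \<open>Taylor coefficients, backward shift and kernels\<close>

lemma Hol_disk_holomorphic: "f \<in> Hol_disk \<Longrightarrow> f holomorphic_on disk"
  by (simp add: Hol_disk_def)

lemma on_disk_mem_Hol_disk: "f holomorphic_on disk \<Longrightarrow> on_disk f \<in> Hol_disk"
  using holomorphic_cong[of disk disk "on_disk f" f] by (auto simp: Hol_disk_def on_disk_def)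

lemma higher_deriv_on_disk:
  assumes "f holomorphic_on disk" "z \<in> disk"
  shows "(deriv ^^ j) (on_disk f) z = (deriv ^^ j) f z"
  by (rule higher_deriv_transform_within_open[OF
        Hol_disk_holomorphic[OF on_disk_mem_Hol_disk[OF assms(1)]] assms(1) open_ball assms(2)])
     (simp add: on_disk_def)

lemma taylor_coeff_0 [simp]: "taylor_coeff f 0 = f 0"
  by (simp add: taylor_coeff_def)

lemma taylor_coeff_zero [simp]: "taylor_coeff (\<lambda>z. 0) k = 0"
  by (simp add: taylor_coeff_def)

lemma taylor_coeff_add:
  "f holomorphic_on disk \<Longrightarrow> g holomorphic_on disk \<Longrightarrow>
    taylor_coeff (\<lambda>z. f z + g z) k = taylor_coeff f k + taylor_coeff g k"
  by (simp add: taylor_coeff_def higher_deriv_add[of _ disk] add_divide_distrib)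

lemma taylor_coeff_cmult:
  "f holomorphic_on disk \<Longrightarrow> taylor_coeff (\<lambda>z. c * f z) k = c * taylor_coeff f k"
  by (simp add: taylor_coeff_def higher_deriv_cmult[of _ disk])

lemma taylor_coeff_mult_ident:
  assumes "f holomorphic_on disk"
  shows "taylor_coeff (\<lambda>z. z * f z) (Suc k) = taylor_coeff f k"
proof -
  have "(deriv ^^ Suc k) (\<lambda>z. z * f z) 0 =
      (\<Sum>i = 0..Suc k. of_nat (Suc k choose i) * (deriv ^^ i) (\<lambda>w. w) 0 * (deriv ^^ (Suc k - i)) f 0)"
    by (rule higher_deriv_mult[of _ disk]) (use assms in \<open>auto intro: holomorphic_intros\<close>)
  \<comment> \<open>Only the first derivative of the identity is nonzero at
    \<open>0\<close>.\<close>
  also have "\<dots> = (\<Sum>i = 0..Suc k. if i = 1 then of_nat (Suc k) * (deriv ^^ k) f 0 else 0)"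
    by (intro sum.cong) auto
  also have "\<dots> = of_nat (Suc k) * (deriv ^^ k) f 0"
    by (subst sum.delta) auto
  finally show ?thesis
    by (simp add: taylor_coeff_def field_simps del: of_nat_Suc funpow.simps)
qed

text \<open>Off \<open>0\<close> the quotient is \<open>q\<close> by cancellation; at
  \<open>0\<close> the derivative of \<open>a + z * q z\<close> is \<open>q 0\<close>, which is the
  value prescribed by the definition. Identities for the shift thus reduce to exhibiting a
  splitting.\<close>

lemma backward_shift_eqI:
  assumes q: "q holomorphic_on disk" and h: "\<And>z. z \<in> disk \<Longrightarrow> h z = a + z * q z"
  shows "backward_shift h = on_disk q"
proof -
  have "(q has_field_derivative deriv q 0) (at 0)"
    using q by (intro holomorphic_derivI[of _ disk]) auto
  then have "((\<lambda>z. a + z * q z) has_field_derivative q 0) (at 0)"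
    by (auto intro!: derivative_eq_intros)
  then have "(h has_field_derivative q 0) (at 0)"
    by (rule has_field_derivative_transform_within_open[where S = disk]) (auto simp: h)
  then show ?thesis
    using h[of 0] h by (auto simp: backward_shift_def on_disk_def DERIV_imp_deriv fun_eq_iff)
qed

text \<open>The singularity of the difference quotient at \<open>0\<close> is removable, so a
  splitting with holomorphic \<open>q\<close> always exists.\<close>

lemma backward_shift_decomp:
  assumes "h holomorphic_on disk"
  obtains a q where "q holomorphic_on disk" "\<And>z. z \<in> disk \<Longrightarrow> h z = a + z * q z"
    "backward_shift h = on_disk q"
proof -
  define q where "q = (\<lambda>z. if z = 0 then deriv h 0 else (h z - h 0) / (z - 0))"
  have "q holomorphic_on disk"
    unfolding q_def by (rule pole_lemma_open[OF assms open_ball])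
  moreover have "h z = h 0 + z * q z" for z by (simp add: q_def)
  ultimately show ?thesis using that backward_shift_eqI by blast
qed

lemma taylor_coeff_backward_shift:
  assumes h: "h holomorphic_on disk"
  shows "taylor_coeff (backward_shift h) k = taylor_coeff h (Suc k)"
proof -
  obtain a q where q: "q holomorphic_on disk" "\<And>z. z \<in> disk \<Longrightarrow> h z = a + z * q z"
    "backward_shift h = on_disk q"
    using backward_shift_decomp[OF h] by blast
  have "(deriv ^^ Suc k) h 0 = (deriv ^^ Suc k) (\<lambda>z. a + z * q z) 0"
    using q h by (intro higher_deriv_transform_within_open[of _ disk]) (auto intro!: holomorphic_intros)
  then have "taylor_coeff h (Suc k) = taylor_coeff (\<lambda>z. a + z * q z) (Suc k)"
    by (simp only: taylor_coeff_def)
  also have "\<dots> = taylor_coeff (\<lambda>z. a) (Suc k) + taylor_coeff (\<lambda>z. z * q z) (Suc k)"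
    using q by (intro taylor_coeff_add) (auto intro!: holomorphic_intros)
  also have "\<dots> = taylor_coeff q k"
    using q(1) by (simp only: taylor_coeff_mult_ident) (simp add: taylor_coeff_def del: funpow.simps)
  also have "\<dots> = taylor_coeff (backward_shift h) k"
    using q by (simp add: taylor_coeff_def higher_deriv_on_disk)
  finally show ?thesis by simp
qed

lemma backward_shift_add:
  assumes "f holomorphic_on disk" "g holomorphic_on disk"
  shows "backward_shift (\<lambda>z. f z + g z) = (\<lambda>z. backward_shift f z + backward_shift g z)"
proof -
  obtain a q where q: "q holomorphic_on disk" "\<And>z. z \<in> disk \<Longrightarrow> f z = a + z * q z"
    "backward_shift f = on_disk q"
    using backward_shift_decomp[OF assms(1)] by blast
  obtain b r where r: "r holomorphic_on disk" "\<And>z. z \<in> disk \<Longrightarrow> g z = b + z * r z"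
    "backward_shift g = on_disk r"
    using backward_shift_decomp[OF assms(2)] by blast
  have "f z + g z = (a + b) + z * (q z + r z)" if "z \<in> disk" for z
    using q(2)[OF that] r(2)[OF that] by (simp add: algebra_simps)
  then have "backward_shift (\<lambda>z. f z + g z) = on_disk (\<lambda>z. q z + r z)"
    using q(1) r(1) by (intro backward_shift_eqI) (auto intro!: holomorphic_intros)
  then show ?thesis by (auto simp: q r on_disk_def)
qed

lemma backward_shift_cmult:
  assumes "f holomorphic_on disk"
  shows "backward_shift (\<lambda>z. c * f z) = (\<lambda>z. c * backward_shift f z)"
proof -
  obtain a q where q: "q holomorphic_on disk" "\<And>z. z \<in> disk \<Longrightarrow> f z = a + z * q z"
    "backward_shift f = on_disk q"
    using backward_shift_decomp[OF assms(1)] by blast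
  have "c * f z = c * a + z * (c * q z)" if "z \<in> disk" for z
    by (subst q(2)[OF that]) (simp add: algebra_simps)
  then have "backward_shift (\<lambda>z. c * f z) = on_disk (\<lambda>z. c * q z)"
    using q(1) by (intro backward_shift_eqI) (auto intro!: holomorphic_intros)
  then show ?thesis by (auto simp: q on_disk_def)
qed

section \<open>Closed form, Taylor coefficients and reproducing property of the kernels\<close>

lemma higher_deriv_geometric:
  fixes w z :: complex
  assumes "1 - w * z \<noteq> 0"
  shows "(deriv ^^ j) (\<lambda>w. 1 / (1 - w * z)) w = fact j * z ^ j / (1 - w * z) ^ Suc j"
  using assms
proof (induction j arbitrary: w)
  case (Suc j)
  \<comment> \<open>Differentiating once more needs the formula for \<open>j\<close> in a
    neighbourhood of \<open>w\<close>, not only at \<open>w\<close>.\<close>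
  have op: "open {w. 1 - w * z \<noteq> 0}"
    by (intro open_Collect_neq continuous_intros)
  have "((\<lambda>w. fact j * z ^ j / (1 - w * z) ^ Suc j) has_field_derivative
      fact (Suc j) * z ^ Suc j / (1 - w * z) ^ Suc (Suc j)) (at w)"
  proof -
    have "((\<lambda>w. fact j * z ^ j / (1 - w * z) ^ Suc j) has_field_derivative
      - (fact j * z ^ j * (of_nat (Suc j) * (1 - w * z) ^ j * (- z))) /
         ((1 - w * z) ^ Suc j * (1 - w * z) ^ Suc j)) (at w)"
      using Suc.prems by (auto intro!: derivative_eq_intros simp del: power_Suc of_nat_Suc)
    moreover have "- (fact j * z ^ j * (of_nat (Suc j) * (1 - w * z) ^ j * (- z))) /
         ((1 - w * z) ^ Suc j * (1 - w * z) ^ Suc j) =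
         fact (Suc j) * z ^ Suc j / (1 - w * z) ^ Suc (Suc j)"
      using Suc.prems by (simp add: divide_simps del: of_nat_Suc)
    ultimately show ?thesis by simp
  qed
  then have "((deriv ^^ j) (\<lambda>w. 1 / (1 - w * z)) has_field_derivative
      fact (Suc j) * z ^ Suc j / (1 - w * z) ^ Suc (Suc j)) (at w)"
    by (rule has_field_derivative_transform_within_open[OF _ op]) (use Suc in auto)
  then show ?case by (simp add: DERIV_imp_deriv)
qed auto

lemma one_minus_mult_neq_0:
  fixes z \<mu> :: complex
  assumes "cmod \<mu> < 1" "cmod z < 1"
  shows "1 - cnj \<mu> * z \<noteq> 0"
proof
  assume "1 - cnj \<mu> * z = 0"
  then have "cmod \<mu> * cmod z = 1"
    by (metis complex_mod_cnj eq_iff_diff_eq_0 norm_mult norm_one)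
  moreover have "cmod \<mu> * cmod z < 1 * 1"
    using assms by (intro mult_strict_mono') auto
  ultimately show False by simp
qed

context
  fixes \<mu> :: complex
  assumes \<mu>: "\<mu> \<in> disk"
begin

lemma kernel_fn_eq: "kernel_fn \<mu> j = on_disk (\<lambda>z. fact j * z ^ j / (1 - cnj \<mu> * z) ^ Suc j)"
  using \<mu> higher_deriv_geometric[OF one_minus_mult_neq_0]
  by (auto simp: kernel_fn_def on_disk_def fun_eq_iff simp del: power_Suc)

lemma kernel_holomorphic: "(\<lambda>z. fact j * z ^ j / (1 - cnj \<mu> * z) ^ k) holomorphic_on disk"
  using \<mu> one_minus_mult_neq_0 by (intro holomorphic_intros) auto

lemma kernel_fn_mem_Hol_disk: "kernel_fn \<mu> j \<in> Hol_disk"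
  unfolding kernel_fn_eq by (intro on_disk_mem_Hol_disk kernel_holomorphic)

text \<open>The kernels at one point form a Jordan chain of the shift with eigenvalue
  \<open>cnj \<mu>\<close>. For \<open>j = 0\<close> the truncated index \<open>j - 1\<close> is
  harmless because of the factor \<open>of_nat j\<close>.\<close>

lemma backward_shift_kernel_fn:
  "backward_shift (kernel_fn \<mu> j) = (\<lambda>z. cnj \<mu> * kernel_fn \<mu> j z + of_nat j * kernel_fn \<mu> (j - 1) z)"
proof -
  define q where "q z = cnj \<mu> * (fact j * z ^ j / (1 - cnj \<mu> * z) ^ Suc j) +
      of_nat j * (fact (j - 1) * z ^ (j - 1) / (1 - cnj \<mu> * z) ^ Suc (j - 1))" for z
  have "q holomorphic_on disk"
    unfolding q_def by (intro holomorphic_intros kernel_holomorphic)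
  \<comment> \<open>The kernel vanishes at \<open>0\<close> unless \<open>j = 0\<close>, where its
    value is \<open>1\<close>.\<close>
  moreover have "kernel_fn \<mu> j z = (if j = 0 then 1 else 0) + z * q z" if "z \<in> disk" for z
  proof -
    have nz: "1 - cnj \<mu> * z \<noteq> 0" using \<mu> that one_minus_mult_neq_0 by auto
    show ?thesis
    proof (cases j)
      case 0
      then show ?thesis using nz that
        by (simp add: kernel_fn_eq on_disk_def q_def divide_simps)
    next
      case (Suc i)
      then show ?thesis using nz that
        by (simp add: kernel_fn_eq on_disk_def q_def divide_simps) (simp add: algebra_simps)
    qed
  qed
  ultimately have "backward_shift (kernel_fn \<mu> j) = on_disk q"
    by (rule backward_shift_eqI)
  then show ?thesis by (auto simp: kernel_fn_eq on_disk_def q_def fun_eq_iff)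
qed

text \<open>Instead of expanding a negative binomial power, the Jordan relation is read as a
  recursion in \<open>k\<close>: the shift lowers the coefficient index by one.\<close>

lemma taylor_coeff_kernel_fn:
  "taylor_coeff (kernel_fn \<mu> j) k = (if j \<le> k then fact k / fact (k - j) * cnj \<mu> ^ (k - j) else 0)"
proof (induction k arbitrary: j)
  case 0
  show ?case by (auto simp: kernel_fn_eq on_disk_def)
next
  case (Suc k)
  have hol: "kernel_fn \<mu> i holomorphic_on disk" for i
    by (intro Hol_disk_holomorphic kernel_fn_mem_Hol_disk)
  have "taylor_coeff (kernel_fn \<mu> j) (Suc k) = taylor_coeff (backward_shift (kernel_fn \<mu> j)) k"
    by (simp add: taylor_coeff_backward_shift hol)
  also have "\<dots> = cnj \<mu> * taylor_coeff (kernel_fn \<mu> j) k + of_nat j * taylor_coeff (kernel_fn \<mu> (j - 1)) k"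
    unfolding backward_shift_kernel_fn
    by (simp add: taylor_coeff_add taylor_coeff_cmult hol holomorphic_intros)
  also have "\<dots> = (if j \<le> Suc k then fact (Suc k) / fact (Suc k - j) * cnj \<mu> ^ (Suc k - j) else 0)"
  proof -
    \<comment> \<open>At \<open>j = Suc k\<close> the first summand vanishes and only the
      neighbouring kernel contributes. In the last case both contribute, and with
      \<open>d = k - j\<close> their factors add up to \<open>Suc d + Suc i = Suc k\<close>.\<close>
    consider "j = 0" | "j > Suc k" | "j = Suc k" | i d where "j = Suc i" "k = i + Suc d"
      by (metis add_Suc_right less_imp_Suc_add linorder_neqE_nat not0_implies_Suc Suc_less_eq)
    then show ?thesis
    proof cases
      case 4
      have "(fact k :: complex) / fact d * x + of_nat (Suc i) * (fact k / fact (Suc d) * x)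
          = fact (Suc k) / fact (Suc d) * x" for x
        using of_nat_neq_0[of d, where ?'a = complex] by (simp add: 4 divide_simps) (simp add: algebra_simps)
      from this[of "cnj \<mu> ^ Suc d"] show ?thesis
        unfolding Suc.IH using 4 by (simp add: algebra_simps del: fact_Suc of_nat_Suc)
    qed (use of_nat_neq_0[of k, where ?'a = complex] in \<open>auto simp: Suc.IH\<close>)
  qed
  finally show ?case .
qed

text \<open>This is the conjugated Taylor series at \<open>0\<close> of the \<open>j\<close>-th
  derivative of \<open>f\<close>, evaluated at \<open>\<mu>\<close> and shifted by \<open>j\<close>;
  the first \<open>j\<close> kernel coefficients are zero. No growth condition on \<open>f\<close>
  is involved.\<close>

lemma kernel_fn_sums:
  assumes f: "f holomorphic_on disk"
  shows "(\<lambda>k. taylor_coeff (kernel_fn \<mu> j) k * cnj (taylor_coeff f k)) sums cnj ((deriv ^^ j) f \<mu>)"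
proof -
  have "(\<lambda>m. (deriv ^^ m) ((deriv ^^ j) f) 0 / fact m * (\<mu> - 0) ^ m) sums (deriv ^^ j) f \<mu>"
    using f \<mu> by (intro holomorphic_power_series[of _ _ 1] holomorphic_higher_deriv) auto
  then have "(\<lambda>m. cnj ((deriv ^^ (m + j)) f 0 / fact m * \<mu> ^ m)) sums cnj ((deriv ^^ j) f \<mu>)"
    by (subst sums_cnj) (simp add: funpow_add)
  also have "(\<lambda>m. cnj ((deriv ^^ (m + j)) f 0 / fact m * \<mu> ^ m)) =
      (\<lambda>m. taylor_coeff (kernel_fn \<mu> j) (m + j) * cnj (taylor_coeff f (m + j)))"
    by (simp add: taylor_coeff_kernel_fn) (simp add: taylor_coeff_def fun_eq_iff)
  finally show ?thesis
    by (subst (asm) sums_iff_shift) (simp add: taylor_coeff_kernel_fn)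
qed

end

section \<open>The model space\<close>

lemma cauchy_series_zero_left [simp]: "cauchy_series (\<lambda>z. 0) f = 0"
  by (simp add: cauchy_series_def)

lemma cauchy_series_add_left:
  assumes "h holomorphic_on disk" "h' holomorphic_on disk"
    and "summable (\<lambda>k. taylor_coeff h k * cnj (taylor_coeff f k))"
    and "summable (\<lambda>k. taylor_coeff h' k * cnj (taylor_coeff f k))"
  shows "cauchy_series (\<lambda>z. h z + h' z) f = cauchy_series h f + cauchy_series h' f"
  using assms by (simp add: cauchy_series_def taylor_coeff_add distrib_right suminf_add)

lemma cauchy_series_cmult_left:
  assumes "h holomorphic_on disk"
    and "summable (\<lambda>k. taylor_coeff h k * cnj (taylor_coeff f k))"
  shows "cauchy_series (\<lambda>z. c * h z) f = c * cauchy_series h f"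
  using assms by (simp add: cauchy_series_def taylor_coeff_cmult mult.assoc suminf_mult)

lemma cauchy_series_add_right:
  assumes "f holomorphic_on disk" "f' holomorphic_on disk"
    and "summable (\<lambda>k. taylor_coeff h k * cnj (taylor_coeff f k))"
    and "summable (\<lambda>k. taylor_coeff h k * cnj (taylor_coeff f' k))"
  shows "cauchy_series h (\<lambda>z. f z + f' z) = cauchy_series h f + cauchy_series h f'"
  using assms by (simp add: cauchy_series_def taylor_coeff_add distrib_left suminf_add)

lemma cauchy_series_cmult_right:
  assumes "f holomorphic_on disk"
    and "summable (\<lambda>k. taylor_coeff h k * cnj (taylor_coeff f k))"
  shows "cauchy_series h (\<lambda>z. c * f z) = cnj c * cauchy_series h f"
  using assms by (simp add: cauchy_series_def taylor_coeff_cmult mult.left_commute suminf_mult)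

text \<open>Both sides have the same terms up to an index shift; the extra head term on the right is
  zero because \<open>z * f z\<close> vanishes at \<open>0\<close>.\<close>

lemma cauchy_series_backward_shift:
  assumes "h holomorphic_on disk" "f holomorphic_on disk"
    and "summable (\<lambda>k. taylor_coeff h k * cnj (taylor_coeff (\<lambda>z. z * f z) k))"
  shows "cauchy_series (backward_shift h) f = cauchy_series h (\<lambda>z. z * f z)"
  using suminf_split_head[OF assms(3)] assms(1,2)
  by (simp add: cauchy_series_def taylor_coeff_backward_shift taylor_coeff_mult_ident)

lemma poly_shift_adjoint_0 [simp]: "poly_shift_adjoint 0 h = (\<lambda>z. 0)"
  by (simp add: poly_shift_adjoint_def)

text \<open>A Horner recursion that opens the operator to induction over polynomials. The zero
  polynomial is separate because \<open>pCons a 0\<close> has degree \<open>0\<close> and not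
  \<open>Suc (degree 0)\<close>.\<close>

lemma poly_shift_adjoint_pCons:
  "poly_shift_adjoint (pCons a p) h = (\<lambda>z. cnj a * h z + poly_shift_adjoint p (backward_shift h) z)"
proof (cases "p = 0")
  case True
  then show ?thesis by (simp add: poly_shift_adjoint_def fun_eq_iff)
next
  case False
  then show ?thesis
    by (simp add: poly_shift_adjoint_def fun_eq_iff sum.atMost_Suc_shift funpow_Suc_right
        del: sum.atMost_Suc funpow.simps(2))
qed

section \<open>The span of the kernels: linearity, convergence and invariance\<close>

lemma model_space_subspace:
  shows model_space_zero: "(\<lambda>z. 0) \<in> model_space n lam mlt"
    and model_space_add: "\<And>h h'. h \<in> model_space n lam mlt \<Longrightarrow> h' \<in> model_space n lam mlt \<Longrightarrow>
      (\<lambda>z. h z + h' z) \<in> model_space n lam mlt"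
    and model_space_cmult: "\<And>c h. h \<in> model_space n lam mlt \<Longrightarrow> (\<lambda>z. c * h z) \<in> model_space n lam mlt"
proof -
  show "(\<lambda>z. 0) \<in> model_space n lam mlt"
    by (auto simp: model_space_def intro!: exI[of _ "\<lambda>i j. 0"])
next
  fix h h' assume "h \<in> model_space n lam mlt" "h' \<in> model_space n lam mlt"
  then obtain c d where "h = (\<lambda>z. \<Sum>i=1..n. \<Sum>j<mlt i. c i j * kernel_fn (lam i) j z)"
    "h' = (\<lambda>z. \<Sum>i=1..n. \<Sum>j<mlt i. d i j * kernel_fn (lam i) j z)"
    by (auto simp: model_space_def)
  then show "(\<lambda>z. h z + h' z) \<in> model_space n lam mlt"
    by (auto simp: model_space_def distrib_right sum.distrib intro!: exI[of _ "\<lambda>i j. c i j + d i j"])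
next
  fix c h assume "h \<in> model_space n lam mlt"
  then obtain d where "h = (\<lambda>z. \<Sum>i=1..n. \<Sum>j<mlt i. d i j * kernel_fn (lam i) j z)"
    by (auto simp: model_space_def)
  then show "(\<lambda>z. c * h z) \<in> model_space n lam mlt"
    by (auto simp: model_space_def sum_distrib_left mult.assoc intro!: exI[of _ "\<lambda>i j. c * d i j"])
qed

lemma kernel_fn_mem_model_space:
  assumes "i \<in> {1..n}" "j < mlt i"
  shows "kernel_fn (lam i) j \<in> model_space n lam mlt"
proof -
  have "(\<Sum>i'=1..n. \<Sum>j'<mlt i'. (if i' = i \<and> j' = j then 1 else 0) * kernel_fn (lam i') j' z)
      = (\<Sum>i'=1..n. if i' = i then (\<Sum>j'<mlt i. if j' = j then kernel_fn (lam i) j z else 0) else 0)" for z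
    by (intro sum.cong refl) (auto simp: mult_if_delta)
  also have "\<dots> z = kernel_fn (lam i) j z" for z
    using assms by simp
  finally show ?thesis
    by (auto simp: model_space_def fun_eq_iff intro!: exI[of _ "\<lambda>i' j'. if i' = i \<and> j' = j then 1 else 0"])
qed

text \<open>Properties linear in \<open>h\<close> need checking on kernels only. The steps for sums
  and multiples supply just \<open>P\<close>, which is why later inductions carry holomorphy or
  membership inside \<open>P\<close>.\<close>

lemma model_space_induct [consumes 1, case_names zero add cmult kernel]:
  assumes h: "h \<in> model_space n lam mlt"
    and zero: "P (\<lambda>z. 0)"
    and add: "\<And>h h'. P h \<Longrightarrow> P h' \<Longrightarrow> P (\<lambda>z. h z + h' z)"
    and cmult: "\<And>c h. P h \<Longrightarrow> P (\<lambda>z. c * h z)"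
    and kernel: "\<And>i j. i \<in> {1..n} \<Longrightarrow> j < mlt i \<Longrightarrow> P (kernel_fn (lam i) j)"
  shows "P h"
proof -
  have sum: "P (\<lambda>z. \<Sum>i\<in>A. F i z)" if "finite A" "\<And>i. i \<in> A \<Longrightarrow> P (F i)"
    for A and F :: "nat \<Rightarrow> complex \<Rightarrow> complex"
    using that by (induction A rule: finite_induct) (auto intro: zero add)
  obtain c where "h = (\<lambda>z. \<Sum>i=1..n. \<Sum>j<mlt i. c i j * kernel_fn (lam i) j z)"
    using h by (auto simp: model_space_def)
  then show ?thesis by (auto intro!: sum cmult kernel)
qed

context
  fixes n :: nat and lam :: "nat \<Rightarrow> complex" and mlt :: "nat \<Rightarrow> nat"
  assumes in_disk: "\<forall>i\<in>{1..n}. lam i \<in> disk"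
begin

lemma model_space_holomorphic:
  assumes "h \<in> model_space n lam mlt"
  shows "h holomorphic_on disk"
  using assms
proof (induction rule: model_space_induct)
  case (kernel i j)
  then show ?case
    using in_disk by (intro Hol_disk_holomorphic kernel_fn_mem_Hol_disk) auto
qed (auto intro!: holomorphic_intros)

lemma model_space_summable:
  assumes "h \<in> model_space n lam mlt" "f holomorphic_on disk"
  shows "summable (\<lambda>k. taylor_coeff h k * cnj (taylor_coeff f k))"
proof -
  have "h holomorphic_on disk \<and> summable (\<lambda>k. taylor_coeff h k * cnj (taylor_coeff f k))"
    using assms(1)
  proof (induction rule: model_space_induct)
    case (kernel i j)
    then show ?case
      using kernel_fn_sums[OF _ assms(2)] Hol_disk_holomorphic[OF kernel_fn_mem_Hol_disk] in_disk
      by (auto simp: sums_iff)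
  qed (auto simp: taylor_coeff_add taylor_coeff_cmult distrib_right mult.assoc
        intro!: holomorphic_intros summable_add summable_mult)
  then show ?thesis ..
qed

lemma model_space_backward_shift:
  assumes "h \<in> model_space n lam mlt"
  shows "backward_shift h \<in> model_space n lam mlt"
proof -
  have "h holomorphic_on disk \<and> backward_shift h \<in> model_space n lam mlt"
    using assms
  proof (induction rule: model_space_induct)
    case zero
    have "backward_shift (\<lambda>z. 0) = (\<lambda>z. 0)"
      by (auto simp: backward_shift_def on_disk_def)
    then show ?case using model_space_zero by auto
  next
    case (kernel i j)
    have "kernel_fn (lam i) j \<in> model_space n lam mlt" "kernel_fn (lam i) (j - 1) \<in> model_space n lam mlt"
      using kernel by (auto intro: kernel_fn_mem_model_space)
    then show ?case
      using kernel in_disk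
      by (auto simp: backward_shift_kernel_fn model_space_holomorphic intro!: model_space_add model_space_cmult)
  qed (auto simp: backward_shift_add backward_shift_cmult
        intro!: holomorphic_intros model_space_add model_space_cmult)
  then show ?thesis ..
qed

lemma model_space_poly_shift_adjoint:
  assumes "h \<in> model_space n lam mlt"
  shows "poly_shift_adjoint p h \<in> model_space n lam mlt"
  using assms
proof (induction p arbitrary: h)
  case 0
  show ?case using model_space_zero by simp
next
  case (pCons a p)
  then show ?case
    unfolding poly_shift_adjoint_pCons
    by (intro model_space_add model_space_cmult pCons.IH model_space_backward_shift)
qed

text \<open>Each Horner step trades one backward shift on the left for a factor \<open>z\<close> on
  the right. The left argument stays in the model space, so all series converge for any holomorphic
  \<open>f\<close>, and the product with \<open>p\<close> need not lie in \<open>X\<close>.\<close>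

lemma cauchy_series_poly_shift_adjoint:
  assumes "h \<in> model_space n lam mlt" and f: "f holomorphic_on disk"
  shows "cauchy_series (poly_shift_adjoint p h) f = cauchy_series h (\<lambda>z. poly p z * f z)"
  using assms(1)
proof (induction p arbitrary: h)
  case 0
  show ?case by (simp add: cauchy_series_def)
next
  case (pCons a p)
  note K = model_space_holomorphic model_space_backward_shift model_space_poly_shift_adjoint
    model_space_cmult pCons.prems
  have pf: "(\<lambda>z. poly p z * f z) holomorphic_on disk"
    using f by (intro holomorphic_intros)
  have "cauchy_series (poly_shift_adjoint (pCons a p) h) f =
      cauchy_series (\<lambda>z. cnj a * h z) f + cauchy_series (poly_shift_adjoint p (backward_shift h)) f"
    unfolding poly_shift_adjoint_pCons
    by (intro cauchy_series_add_left model_space_summable f K)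
  also have "cauchy_series (poly_shift_adjoint p (backward_shift h)) f =
      cauchy_series (backward_shift h) (\<lambda>z. poly p z * f z)"
    by (intro pCons.IH K)
  also have "\<dots> = cauchy_series h (\<lambda>z. z * (poly p z * f z))"
    by (intro cauchy_series_backward_shift model_space_summable K pf holomorphic_intros)
  also have "cauchy_series (\<lambda>z. cnj a * h z) f = cnj a * cauchy_series h f"
    by (intro cauchy_series_cmult_left model_space_summable f K)
  also have "cnj a * cauchy_series h f = cauchy_series h (\<lambda>z. a * f z)"
    by (intro cauchy_series_cmult_right[symmetric] model_space_summable f K)
  also have "\<dots> + cauchy_series h (\<lambda>z. z * (poly p z * f z)) =
      cauchy_series h (\<lambda>z. a * f z + z * (poly p z * f z))"
    by (intro cauchy_series_add_right[symmetric] model_space_summable K pf f holomorphic_intros)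
  finally show ?case by (simp add: algebra_simps)
qed

text \<open>By the reproducing property a kernel sees only one derivative of \<open>f\<close> at one
  node, and linearity carries this to the whole span.\<close>

lemma cauchy_series_model_space_cong:
  assumes "h \<in> model_space n lam mlt" and f: "f holomorphic_on disk" "f' holomorphic_on disk"
    and eq: "\<And>i j. i \<in> {1..n} \<Longrightarrow> j < mlt i \<Longrightarrow> (deriv ^^ j) f (lam i) = (deriv ^^ j) f' (lam i)"
  shows "cauchy_series h f = cauchy_series h f'"
proof -
  have "h \<in> model_space n lam mlt \<and> cauchy_series h f = cauchy_series h f'"
    using assms(1)
  proof (induction rule: model_space_induct)
    case (kernel i j)
    then show ?case
      using kernel_fn_sums[of "lam i"] f in_disk eq kernel_fn_mem_model_space[of i n j mlt lam]
      by (auto simp: cauchy_series_def sums_iff)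
  qed (auto simp: cauchy_series_add_left cauchy_series_cmult_left model_space_summable f
        model_space_holomorphic model_space_zero model_space_add model_space_cmult)
  then show ?thesis ..
qed

end

text \<open>In the Leibniz formula the derivative of order \<open>j\<close> involves
  \<open>f\<close> only through derivatives of order at most \<open>j\<close>, so agreement below
  order \<open>m\<close> survives multiplication by \<open>u\<close>.\<close>

lemma higher_deriv_mult_cong:
  fixes f :: "complex \<Rightarrow> complex"
  assumes "f holomorphic_on S" "f' holomorphic_on S" "u holomorphic_on S" "open S" "z \<in> S"
    and eq: "\<And>j. j < m \<Longrightarrow> (deriv ^^ j) f z = (deriv ^^ j) f' z" and j: "j < m"
  shows "(deriv ^^ j) (\<lambda>z. f z * u z) z = (deriv ^^ j) (\<lambda>z. f' z * u z) z"
  using assms by (auto simp: higher_deriv_mult[of _ S] intro!: sum.cong)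

section \<open>Duality\<close>

context exact_predual
begin

lemma pair_cmult: "h \<in> Y \<Longrightarrow> f \<in> X \<Longrightarrow> pair (\<lambda>z. c * h z) f = c * pair h f"
  using pair_bounded[of f] by (auto simp: bounded_functional_def)

lemma norm_pos:
  shows "h \<in> Y \<Longrightarrow> h \<noteq> (\<lambda>z. 0) \<Longrightarrow> NY h > 0"
    and "f \<in> X \<Longrightarrow> f \<noteq> (\<lambda>z. 0) \<Longrightarrow> NX f > 0"
  using X.norm_nonneg X.norm_eq_zero Y.norm_nonneg Y.norm_eq_zero by (fastforce simp: less_le)+

lemma norm_pair_le:
  assumes h: "h \<in> Y" and f: "f \<in> X"
  shows "cmod (pair h f) \<le> NX f * NY h"
\<comment> \<open>The supremum in \<open>norm_X\<close> omits the zero function, for which the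
  pairing vanishes by homogeneity.\<close>
proof (cases "h = (\<lambda>z. 0)")
  case True
  then show ?thesis
    using pair_cmult[OF Y.zero_mem f, of 0] Y.norm_eq_zero[OF Y.zero_mem] by simp
next
  case False
  have "ennreal (cmod (pair h f) / NY h) \<le> ennreal (NX f)"
    unfolding norm_X[OF f] using h False by (intro SUP_upper) auto
  then show ?thesis
    using norm_pos(1)[OF h False] X.norm_nonneg[OF f] by (simp add: field_simps)
qed

lemma norm_X_le:
  assumes f: "f \<in> X" and "C \<ge> 0" and "\<And>h. h \<in> Y \<Longrightarrow> cmod (pair h f) \<le> C * NY h"
  shows "NX f \<le> C"
proof -
  have "ennreal (NX f) \<le> ennreal C"
    unfolding norm_X[OF f] using assms norm_pos(1)
    by (intro SUP_least ennreal_leI) (auto simp: field_simps)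
  then show ?thesis using \<open>C \<ge> 0\<close> by simp
qed

lemma norm_Y_le:
  assumes h: "h \<in> Y" and "C \<ge> 0" and "\<And>f. f \<in> X \<Longrightarrow> cmod (pair h f) \<le> C * NX f"
  shows "NY h \<le> C"
proof -
  have "ennreal (NY h) \<le> ennreal C"
    unfolding norm_Y[OF h] using assms norm_pos(2)
    by (intro SUP_least ennreal_leI) (auto simp: field_simps)
  then show ?thesis using \<open>C \<ge> 0\<close> by simp
qed

text \<open>Hahn-Banach with the seminorm \<open>M * NY\<close> keeps the bound \<open>M\<close>;
  the extension is represented in \<open>X\<close> by duality, and the formula for \<open>NX\<close>
  turns the bound into one on the norm.\<close>

lemma functional_extension:
  assumes K: "K \<subseteq> Y" "(\<lambda>z. 0) \<in> K" "\<And>h h'. h \<in> K \<Longrightarrow> h' \<in> K \<Longrightarrow> (\<lambda>z. h z + h' z) \<in> K"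
      "\<And>c h. h \<in> K \<Longrightarrow> (\<lambda>z. c * h z) \<in> K"
    and L: "\<And>h h'. h \<in> K \<Longrightarrow> h' \<in> K \<Longrightarrow> L (\<lambda>z. h z + h' z) = L h + L h'"
      "\<And>c h. h \<in> K \<Longrightarrow> L (\<lambda>z. c * h z) = c * L h"
    and M: "M \<ge> 0" "\<And>h. h \<in> K \<Longrightarrow> cmod (L h) \<le> M * NY h"
  shows "\<exists>f\<in>X. NX f \<le> M \<and> (\<forall>h\<in>K. pair h f = L h)"
proof -
  define s where "s c h = (\<lambda>z. c * h z)" for c :: complex and h :: "complex \<Rightarrow> complex"
  interpret V: vector_space s
    by unfold_locales (auto simp: s_def algebra_simps)
  have subY: "V.subspace Y" and subK: "V.subspace K"
    using Y.zero_mem Y.add_mem Y.scale_mem K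
    by (auto simp: V.subspace_def s_def zero_fun_def plus_fun_def)
  have "\<exists>\<Lambda>. (\<forall>h\<in>K. \<Lambda> h = L h) \<and> (\<forall>h\<in>Y. \<forall>h'\<in>Y. \<Lambda> (h + h') = \<Lambda> h + \<Lambda> h') \<and>
      (\<forall>h\<in>Y. \<forall>c. \<Lambda> (s c h) = c * \<Lambda> h) \<and> (\<forall>h\<in>Y. cmod (\<Lambda> h) \<le> M * NY h)"
  proof (intro hahn_banach_complex[OF V.vector_space_axioms subY subK \<open>K \<subseteq> Y\<close>])
    fix h h' assume "h \<in> Y" "h' \<in> Y"
    then show "M * NY (h + h') \<le> M * NY h + M * NY h'"
      using Y.norm_triangle[of h h'] \<open>M \<ge> 0\<close>
      by (simp add: plus_fun_def mult_left_mono flip: distrib_left)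
  qed (use L M in \<open>auto simp: s_def plus_fun_def Y.norm_scale\<close>)
  then obtain \<Lambda> where \<Lambda>: "\<And>h. h \<in> K \<Longrightarrow> \<Lambda> h = L h"
    "\<And>h h'. h \<in> Y \<Longrightarrow> h' \<in> Y \<Longrightarrow> \<Lambda> (\<lambda>z. h z + h' z) = \<Lambda> h + \<Lambda> h'"
    "\<And>h c. h \<in> Y \<Longrightarrow> \<Lambda> (\<lambda>z. c * h z) = c * \<Lambda> h"
    "\<And>h. h \<in> Y \<Longrightarrow> cmod (\<Lambda> h) \<le> M * NY h"
    unfolding s_def plus_fun_def by blast
  then have "bounded_functional Y NY \<Lambda>"
    unfolding bounded_functional_def by blast
  then obtain f where f: "f \<in> X" "\<And>h. h \<in> Y \<Longrightarrow> \<Lambda> h = pair h f"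
    using represent by blast
  show ?thesis
  proof (intro bexI[OF _ f(1)] conjI ballI)
    show "NX f \<le> M"
      using \<Lambda>(4) f M(1) by (intro norm_X_le) auto
    show "pair h f = L h" if "h \<in> K" for h
      using that f(2) \<Lambda>(1) K(1) by (metis subsetD)
  qed
qed

end

section \<open>The two inequalities between interpolation norm and operator norm\<close>

theorem theorem2:
  fixes X Y :: "(complex \<Rightarrow> complex) set"
    and NX NY :: "(complex \<Rightarrow> complex) \<Rightarrow> real"
    and pair :: "(complex \<Rightarrow> complex) \<Rightarrow> (complex \<Rightarrow> complex) \<Rightarrow> complex"
    and n :: nat and lam :: "nat \<Rightarrow> complex" and mlt :: "nat \<Rightarrow> nat"
    and g :: "complex poly"
  assumes algebra: "unital_hol_banach_algebra X NX"
    and predual: "exact_predual X NX Y NY pair"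
    and division: "\<forall>h\<in>Y. backward_shift h \<in> Y"
    and in_disk: "\<forall>i\<in>{1..n}. lam i \<in> disk"
    and distinct: "inj_on lam {1..n}"
    and mult_pos: "\<forall>i\<in>{1..n}. mlt i \<ge> 1"
    and model_subset: "model_space n lam mlt \<subseteq> Y"
    and pair_model: "\<forall>h\<in>model_space n lam mlt. \<forall>f\<in>X. pair h f = cauchy_series h f"
  shows "interpolation_norm X NX n lam mlt g =
         restricted_opnorm (model_space n lam mlt) NY (poly_shift_adjoint g)"
proof -
  interpret A: unital_hol_banach_algebra X NX by (rule algebra)
  interpret P: exact_predual X NX Y NY pair by (rule predual)
  define K where "K = model_space n lam mlt"
  define T where "T = poly_shift_adjoint g"
  define one where "one = on_disk (\<lambda>z. 1)"
  have KY: "h \<in> Y" if "h \<in> K" for h using that model_subset K_def by blast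
  have TK: "T h \<in> K" if "h \<in> K" for h
    using that model_space_poly_shift_adjoint[OF in_disk] by (simp add: K_def T_def)
  have pairK: "pair h f = cauchy_series h f" if "h \<in> K" "f \<in> X" for h f
    using that pair_model K_def by blast
  have Xhol: "f holomorphic_on disk" if "f \<in> X" for f
    using that A.subset_Hol Hol_disk_holomorphic by blast
  have pairT: "pair (T h) f = cauchy_series h (\<lambda>z. poly g z * f z)" if "h \<in> K" "f \<in> X" for h f
    using that TK pairK cauchy_series_poly_shift_adjoint[OF in_disk _ Xhol]
    by (simp add: K_def T_def)
  have "restricted_opnorm K NY T \<le> ennreal (NX F)"
    if F: "F \<in> X" and eq: "\<forall>i\<in>{1..n}. \<forall>j<mlt i. (deriv ^^ j) F (lam i) = (deriv ^^ j) (poly g) (lam i)"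
    for F
    unfolding restricted_opnorm_def
  proof (intro SUP_least ennreal_leI)
    fix h assume h: "h \<in> K - {\<lambda>z. 0}"
    have "NY (T h) \<le> NX F * NY h"
    \<comment> \<open>The norm of \<open>T h\<close> is computed by testing against all
      \<open>f\<close> in \<open>X\<close>.\<close>
    proof (rule P.norm_Y_le)
      show "T h \<in> Y" "0 \<le> NX F * NY h"
        using h TK KY A.norm_nonneg[OF F] P.Y.norm_nonneg by auto
      fix f assume f: "f \<in> X"
      have "pair (T h) f = cauchy_series h (\<lambda>z. poly g z * f z)"
        using h f pairT by blast
      \<comment> \<open>\<open>F\<close> and \<open>g\<close> agree at the nodes to the required
        orders, hence so do their products with \<open>f\<close>. This replaces \<open>g\<close> by
        \<open>F\<close>, whose product with \<open>f\<close> lies in the algebra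
        \<open>X\<close>.\<close>
      also have "\<dots> = cauchy_series h (\<lambda>z. F z * f z)"
      proof (rule cauchy_series_model_space_cong[OF in_disk, where mlt = mlt])
        fix i j assume ij: "i \<in> {1..n}" "j < mlt i"
        show "(deriv ^^ j) (\<lambda>z. poly g z * f z) (lam i) = (deriv ^^ j) (\<lambda>z. F z * f z) (lam i)"
          using ij eq in_disk Xhol[OF F] Xhol[OF f]
          by (intro higher_deriv_mult_cong[of _ disk _ _ _ "mlt i"]) (auto intro: holomorphic_intros)
      qed (use h Xhol[OF F] Xhol[OF f] in \<open>auto simp: K_def intro!: holomorphic_intros\<close>)
      also have "\<dots> = pair h (\<lambda>z. F z * f z)"
        using h pairK A.mult_mem[OF F f] by simp
      finally have "cmod (pair (T h) f) \<le> NX (\<lambda>z. F z * f z) * NY h"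
        using h KY P.norm_pair_le A.mult_mem[OF F f] by simp
      also have "\<dots> \<le> (NX F * NX f) * NY h"
        using h KY by (intro mult_right_mono A.norm_mult F f P.Y.norm_nonneg) auto
      finally show "cmod (pair (T h) f) \<le> NX F * NY h * NX f" by (simp add: mult_ac)
    qed
    then show "NY (T h) / NY h \<le> NX F"
      using h P.norm_pos(1)[OF KY] by (auto simp: field_simps)
  qed
  then have ge: "restricted_opnorm K NY T \<le> interpolation_norm X NX n lam mlt g"
    unfolding interpolation_norm_def by (intro INF_greatest) auto
  have le: "interpolation_norm X NX n lam mlt g \<le> restricted_opnorm K NY T"
  \<comment> \<open>An infinite operator norm makes the inequality trivial; otherwise it is a real
    \<open>M\<close> that can dominate a functional.\<close>
  proof (cases "restricted_opnorm K NY T = top")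
    case False
    then obtain M where M: "restricted_opnorm K NY T = ennreal M" "M \<ge> 0"
      by (cases "restricted_opnorm K NY T") auto
    \<comment> \<open>\<open>L h = \<langle>g(S)\<^sup>\<star> h, 1\<rangle>\<close>, and the unit has norm \<open>1\<close>.\<close>
    define L where "L h = cauchy_series h (on_disk (poly g))" for h
    have one: "one \<in> X" "NX one = 1" using A.one_mem A.norm_one by (auto simp: one_def)
    have g_hol: "on_disk (poly g) holomorphic_on disk"
      by (intro Hol_disk_holomorphic on_disk_mem_Hol_disk holomorphic_intros)
    have L_le: "cmod (L h) \<le> M * NY h" if h: "h \<in> K" for h
    proof (cases "h = (\<lambda>z. 0)")
      case True
      then show ?thesis using M(2) P.Y.norm_nonneg KY h by (simp add: L_def)
    next
      case h0: False
      have "(\<lambda>z. poly g z * one z) = on_disk (poly g)"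
        by (auto simp: one_def on_disk_def)
      then have "cmod (L h) = cmod (pair (T h) one)"
        using pairT[OF h one(1)] by (simp add: L_def)
      also have "\<dots> \<le> NY (T h)"
        using P.norm_pair_le[OF KY[OF TK[OF h]] one(1)] one(2) by simp
      also have "ennreal (NY (T h) / NY h) \<le> ennreal M"
        unfolding M(1)[symmetric] restricted_opnorm_def using h h0 by (intro SUP_upper) auto
      then have "NY (T h) \<le> M * NY h"
        using M(2) P.norm_pos(1)[OF KY[OF h] h0] by (simp add: field_simps)
      finally show ?thesis .
    qed
    have hol: "h holomorphic_on disk"
      and summ: "summable (\<lambda>k. taylor_coeff h k * cnj (taylor_coeff (on_disk (poly g)) k))"
      if "h \<in> K" for h
      using that model_space_holomorphic[OF in_disk] model_space_summable[OF in_disk _ g_hol]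
      by (auto simp: K_def)
    have "\<exists>F\<in>X. NX F \<le> M \<and> (\<forall>h\<in>K. pair h F = L h)"
    proof (rule P.functional_extension)
      show "K \<subseteq> Y" using KY by blast
    qed (use L_le M(2) hol summ in \<open>auto simp: K_def L_def cauchy_series_add_left
        cauchy_series_cmult_left model_space_subspace\<close>)
    then obtain F where F: "F \<in> X" "NX F \<le> M" "\<And>h. h \<in> K \<Longrightarrow> pair h F = L h"
      by blast
    have "(deriv ^^ j) F (lam i) = (deriv ^^ j) (poly g) (lam i)" if ij: "i \<in> {1..n}" "j < mlt i" for i j
    proof -
      \<comment> \<open>Equality of the functionals on \<open>K\<close>, tested on this kernel, is
        equality of the \<open>j\<close>-th derivatives at \<open>lam i\<close> by the reproducing
        property.\<close>
      have k: "kernel_fn (lam i) j \<in> K" and d: "lam i \<in> disk"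
        using ij in_disk kernel_fn_mem_model_space by (auto simp: K_def)
      have "cauchy_series (kernel_fn (lam i) j) F = cauchy_series (kernel_fn (lam i) j) (on_disk (poly g))"
        using F(3)[OF k] pairK[OF k F(1)] by (simp add: L_def)
      then have "(deriv ^^ j) F (lam i) = (deriv ^^ j) (on_disk (poly g)) (lam i)"
        using kernel_fn_sums[OF d Xhol[OF F(1)], of j] kernel_fn_sums[OF d g_hol, of j]
        by (simp add: cauchy_series_def sums_iff)
      then show ?thesis
        using d by (simp add: higher_deriv_on_disk holomorphic_intros)
    qed
    then have "interpolation_norm X NX n lam mlt g \<le> ennreal (NX F)"
      unfolding interpolation_norm_def using F(1) by (intro INF_lower) auto
    also have "\<dots> \<le> ennreal M" using F(2) by (rule ennreal_leI)
    finally show ?thesis by (simp add: M(1))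
  qed simp
  show ?thesis using antisym[OF le ge] by (simp add: K_def T_def)
qed

end
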